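(* Let $\Pi$ be the map on $\mathbb{N}=\{1,2,3,\dots\}$ produced by the following procedure. At step $1$ set $\Pi(1)=1$. For $m=2,3,4,\dots$ in turn, at step $m$: if $\Pi(m-\lfloor m/2\rfloor)$ has not been assigned at an earlier step, set $\Pi(m-\lfloor m/2\rfloor)=m$; otherwise set $\Pi(m+\lfloor m/2\rfloor)=m$. Let $n,k\ge 1$ be natural numbers. Then: (a) $\Pi(n)$ never has type (II); (b) if $n=3k$ then $\Pi(n)$ has type (IV); (c) if $n=3k+2$ then $\Pi(n)$ has type (I); (d) if $n=3k+1$ then $\Pi(n)$ has type (I) if $\Pi(k+1)$ has type (I), and $\Pi(n)$ has type (III) if $\Pi(k+1)$ has type (III) or type (IV).
   Context: The procedure assigns a value $\Pi(n)$ to every $n\in\mathbb{N}$. Types: $\Pi(n)$ has type (I) if $\Pi(n)>n$ and $\Pi(n)=2n-1$; type (II) if $\Pi(n)>n$ and $\Pi(n)=2n$; type (III) if $\Pi(n)<n$ and $\Pi(n)=(2n+1)/3$; type (IV) if $\Pi(n)<n$ and $\Pi(n)=2n/3$. *)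

theory Defs
  imports Complex_Main
begin

text \<open>
  The positions and values are the positive integers, so position \<open>0\<close> is never
  assigned. \<open>assigned m\<close> is the partial map consisting of the assignments made in
  the steps \<open>1, \<dots>, m\<close>; on \<open>nat\<close>, \<open>m div 2\<close> is the floor of \<open>m / 2\<close>.
\<close>

definition proc_step :: "nat \<Rightarrow> (nat \<rightharpoonup> nat) \<Rightarrow> (nat \<rightharpoonup> nat)" where
  "proc_step m f =
    (if f (m - m div 2) = None then f(m - m div 2 \<mapsto> m) else f(m + m div 2 \<mapsto> m))"

fun assigned :: "nat \<Rightarrow> (nat \<rightharpoonup> nat)" where
  "assigned 0 = Map.empty"
| "assigned (Suc 0) = [1 \<mapsto> 1]"
| "assigned (Suc (Suc j)) = proc_step (Suc (Suc j)) (assigned (Suc j))"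

text \<open>
  The map produced by the infinite procedure: the value that position \<open>n\<close> carries
  from some step on. The lemma \<open>Prc_eventually\<close> shows that this value exists for every
  \<open>n \<ge> 1\<close>, so the description is never vacuous there.
\<close>

definition Prc :: "nat \<Rightarrow> nat" where
  "Prc n = (THE v. \<forall>\<^sub>F m in sequentially. assigned m n = Some v)"

definition type_I :: "nat \<Rightarrow> bool" where
  "type_I n \<longleftrightarrow> Prc n > n \<and> real (Prc n) = 2 * real n - 1"

definition type_II :: "nat \<Rightarrow> bool" where
  "type_II n \<longleftrightarrow> Prc n > n \<and> real (Prc n) = 2 * real n"

definition type_III :: "nat \<Rightarrow> bool" where
  "type_III n \<longleftrightarrow> Prc n < n \<and> real (Prc n) = (2 * real n + 1) / 3"

definition type_IV :: "nat \<Rightarrow> bool" where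
  "type_IV n \<longleftrightarrow> Prc n < n \<and> real (Prc n) = 2 * real n / 3"

lemma assigned_step:
  assumes "m \<ge> 2"
  shows "assigned m = proc_step m (assigned (m - 1))"
proof -
  obtain j where "m = Suc (Suc j)"
    using assms by (metis One_nat_def Suc_1 Suc_le_D Suc_le_mono)
  then show ?thesis by simp
qed

lemma assigned_by:
  assumes "n \<ge> 1"
  shows "assigned (2 * n - 1) n \<noteq> None"
proof (cases "n = 1")
  case False
  then have "2 * n - 1 \<ge> 2" and "(2 * n - 1) - (2 * n - 1) div 2 = n"
    using assms by auto
  then show ?thesis
    unfolding assigned_step[OF \<open>2 * n - 1 \<ge> 2\<close>] proc_step_def
    by (simp split: if_splits)
qed simp

lemma assigned_stable:
  assumes "n \<ge> 1" and "m \<ge> 2 * n - 1"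
  shows "assigned m n = assigned (2 * n - 1) n"
  using assms(2)
proof (induction m rule: dec_induct)
  case (step m)
  have "assigned (Suc m) = proc_step (Suc m) (assigned m)"
    using step.hyps assms(1) assigned_step[of "Suc m"] by simp
  moreover have "assigned m n \<noteq> None"
    using step.IH assigned_by[OF assms(1)] by simp
  moreover have "Suc m + Suc m div 2 \<noteq> n"
    using step.hyps assms(1) by linarith
  ultimately show ?case
    using step.IH by (auto simp: proc_step_def)
qed simp

lemma Prc_eventually:
  assumes "n \<ge> 1"
  shows "\<forall>\<^sub>F m in sequentially. assigned m n = Some (Prc n)"
proof -
  obtain v where v: "assigned (2 * n - 1) n = Some v"
    using assigned_by[OF assms] by blast
  have ev: "\<forall>\<^sub>F m in sequentially. assigned m n = Some v"
    by (rule eventually_sequentiallyI[of "2 * n - 1"]) (use assigned_stable[OF assms] v in metis)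
  have "w = v" if "\<forall>\<^sub>F m in sequentially. assigned m n = Some w" for w
  proof -
    have "\<forall>\<^sub>F m in sequentially. Some w = Some v"
      using that ev by eventually_elim simp
    then show ?thesis by simp
  qed
  then have "Prc n = v"
    unfolding Prc_def using ev by blast
  then show ?thesis using ev by simp
qed

end

theory Submission
  imports Defs
begin

text \<open>
  A value \<open>v\<close> is only ever written in step \<open>v\<close>, so \<open>Prc n = v\<close> forces \<open>n\<close> to be one of the two
  target positions of step \<open>v\<close>. Step \<open>2p\<close> always finds \<open>p\<close> occupied and hence writes to \<open>3p\<close>;
  step \<open>2p + 1\<close> writes to \<open>p + 1\<close> or to \<open>3p + 1\<close>. The residue of \<open>n\<close> modulo 3 therefore
  decides which steps can reach \<open>n\<close>, and for \<open>n = 3k + 1\<close> the outcome depends only on whether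
  \<open>k + 1\<close> is occupied before step \<open>2k + 1\<close>.
\<close>

lemma assigned_mono:
  assumes "assigned m n \<noteq> None" and "m \<le> m'"
  shows "assigned m' n \<noteq> None"
  using assms(2)
proof (induction m' rule: dec_induct)
  case (step i)
  then have "i \<noteq> 0"
    using assms(1) by (cases i) auto
  then show ?case
    using step.IH assigned_step[of "Suc i"] by (auto simp: proc_step_def)
qed (use assms(1) in simp)

text \<open>The occupancy test in the conclusion refers to the state just before step
  \<open>v\<close>, so the information is independent of \<open>m\<close> and survives the
  induction.\<close>

lemma assigned_SomeD:
  assumes "assigned m n = Some v"
  shows "v = 1 \<and> n = 1 \<or>
    v \<ge> 2 \<and> n = (if assigned (v - 1) (v - v div 2) = None then v - v div 2 else v + v div 2)"
  using assms
proof (induction m rule: assigned.induct)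
  case (3 j)
  show ?case
  proof (cases "assigned (Suc j) n = Some v")
    case True
    then show ?thesis by (rule "3.IH")
  next
    case False
    with "3.prems" have "v = Suc (Suc j)"
      and "n = (if assigned (Suc j) (v - v div 2) = None then v - v div 2 else v + v div 2)"
      by (auto simp: proc_step_def simp del: div2_Suc_Suc split: if_splits)
    then show ?thesis by simp
  qed
qed (simp_all split: if_splits)

text \<open>Position \<open>p\<close> is filled by the end of step \<open>2 * p - 1\<close>, so step
  \<open>2 * p\<close>, whose first target is \<open>p\<close>, is diverted to its second
  target.\<close>

lemma assigned_double:
  assumes "p \<ge> 1"
  shows "assigned (2 * p) (3 * p) = Some (2 * p)"
proof -
  have "assigned (2 * p - 1) p \<noteq> None"
    using assms by (rule assigned_by)
  with assms assigned_step[of "2 * p"] show ?thesis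
    by (auto simp: proc_step_def)
qed

lemma assigned_odd:
  assumes "p \<ge> 1"
  shows "assigned (2 * p + 1) =
    (if assigned (2 * p) (p + 1) = None
     then (assigned (2 * p))(p + 1 \<mapsto> 2 * p + 1)
     else (assigned (2 * p))(3 * p + 1 \<mapsto> 2 * p + 1))"
  using assms assigned_step[of "2 * p + 1"] by (simp add: proc_step_def)

text \<open>Trades the limit defining \<open>Prc\<close> for a finite stage after which position
  \<open>n\<close> no longer changes.\<close>

lemma assigned_Prc:
  assumes "n \<ge> 1"
  shows "assigned (2 * n - 1) n = Some (Prc n)"
proof -
  have "\<forall>\<^sub>F m in sequentially. assigned m n = assigned (2 * n - 1) n"
    using assigned_stable[OF assms] by (rule eventually_sequentiallyI)
  with Prc_eventually[OF assms]
  have "\<forall>\<^sub>F m in sequentially. assigned (2 * n - 1) n = Some (Prc n)"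
    by eventually_elim simp
  then show ?thesis by simp
qed

text \<open>Recovers from a position the step that wrote it. The cases \<open>first\<close> and
  \<open>second\<close> tell which target the odd step \<open>2 * p + 1\<close> used; an even step
  can only have used its second target.\<close>

lemma Prc_cases [consumes 1, case_names one even first second]:
  assumes "n \<ge> 1"
  obtains "n = 1" "Prc n = 1"
  | p where "p \<ge> 1" "n = 3 * p" "Prc n = 2 * p"
  | p where "p \<ge> 1" "n = p + 1" "Prc n = 2 * p + 1" "assigned (2 * p) (p + 1) = None"
  | p where "p \<ge> 1" "n = 3 * p + 1" "Prc n = 2 * p + 1" "assigned (2 * p) (p + 1) \<noteq> None"
proof -
  obtain v where v: "Prc n = v" by blast
  consider "v = 1" "n = 1"
    | "v \<ge> 2"
      "n = (if assigned (v - 1) (v - v div 2) = None then v - v div 2 else v + v div 2)"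
    using assigned_SomeD[OF assigned_Prc[OF assms]] v by blast
  then show ?thesis
  proof cases
    case 1
    with that(1) v show ?thesis by simp
  next
    case 2
    show ?thesis
    proof (cases "even v")
      case True
      then obtain p where p: "v = 2 * p" by blast
      with 2 have "p \<ge> 1" by simp
      then have "assigned (2 * p - 1) p \<noteq> None"
        by (rule assigned_by)
      with p 2 have "n = 3 * p" by (auto split: if_splits)
      with \<open>p \<ge> 1\<close> p v show ?thesis by (intro that(2)[of p]) simp_all
    next
      case False
      then obtain p where p: "v = 2 * p + 1" by (elim oddE)
      with 2 have "p \<ge> 1" by simp
      show ?thesis
      proof (cases "assigned (2 * p) (p + 1) = None")
        case True
        with 2 p v \<open>p \<ge> 1\<close> show ?thesis by (intro that(3)[of p]) simp_all
      next
        case False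
        with 2 p v \<open>p \<ge> 1\<close> show ?thesis by (intro that(4)[of p]) simp_all
      qed
    qed
  qed
qed

lemma Prc_mod3_0:
  assumes "k \<ge> 1"
  shows "Prc (3 * k) = 2 * k"
proof -
  have "3 * k \<ge> 1" using assms by simp
  then show ?thesis
  proof (cases rule: Prc_cases)
    case (first p)
    \<comment> \<open>Here \<open>p = 3 * k - 1\<close>, and \<open>3 * k\<close> would have to be
      free after step \<open>2 * p\<close>; but the earlier step \<open>2 * k\<close> has filled
      it.\<close>
    then have "2 * k \<le> 2 * p" using assms by linarith
    with assigned_mono[of "2 * k" "3 * k" "2 * p"] assigned_double[OF assms] first
    show ?thesis by simp
  next
    case one
    then have False by presburger
    then show ?thesis ..
  next
    case (second p)
    then have False by presburger
    then show ?thesis ..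
  qed simp
qed

text \<open>Second targets \<open>3 * p\<close> and \<open>3 * p + 1\<close> miss the residue 2,
  which leaves only the first target of an odd step.\<close>

lemma Prc_mod3_2: "Prc (3 * k + 2) = 2 * (3 * k + 2) - 1"
proof -
  have "3 * k + 2 \<ge> 1" by simp
  then show ?thesis
  proof (cases rule: Prc_cases)
    case (even p)
    then have False by presburger
    then show ?thesis ..
  next
    case (second p)
    then have False by presburger
    then show ?thesis ..
  qed simp_all
qed

text \<open>Steps \<open>2 * k + 1\<close> and \<open>6 * k + 1\<close> compete for this position.
  The earlier one takes it exactly when it finds its first target \<open>k + 1\<close>
  occupied.\<close>

lemma Prc_mod3_1:
  assumes "k \<ge> 1"
  shows "Prc (3 * k + 1) =
    (if assigned (2 * k) (k + 1) = None then 2 * (3 * k + 1) - 1 else 2 * k + 1)"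
proof -
  have "3 * k + 1 \<ge> 1" by simp
  then show ?thesis
  proof (cases rule: Prc_cases)
    case (first p)
    then have p: "p = 3 * k" by simp
    have "assigned (2 * k) (k + 1) = None"
    proof (rule ccontr)
      \<comment> \<open>Step \<open>2 * k + 1\<close> would then fill \<open>3 * k + 1\<close>
        before step \<open>2 * p + 1 = 6 * k + 1\<close> finds it free.\<close>
      assume "assigned (2 * k) (k + 1) \<noteq> None"
      then have "assigned (2 * k + 1) (3 * k + 1) \<noteq> None"
        unfolding assigned_odd[OF assms] by auto
      then have "assigned (2 * p) (3 * k + 1) \<noteq> None"
        by (rule assigned_mono) (use assms p in simp)
      with first(4) p show False by simp
    qed
    with first p show ?thesis by simp
  next
    case (second p)
    then have "p = k" by simp
    with second show ?thesis by simp
  next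
    case one
    with assms show ?thesis by simp
  next
    case (even p)
    then have False by presburger
    then show ?thesis ..
  qed
qed

text \<open>Since \<open>2 * k + 1 = 2 * (k + 1) - 1\<close>, this turns the occupancy test of
  \<open>Prc_mod3_1\<close> into the question whether \<open>k + 1\<close> has type (I).\<close>

lemma Prc_eq_iff_unassigned:
  assumes "k \<ge> 1"
  shows "Prc (k + 1) = 2 * k + 1 \<longleftrightarrow> assigned (2 * k) (k + 1) = None"
proof
  assume v: "Prc (k + 1) = 2 * k + 1"
  have "k + 1 \<ge> 1" by simp
  then show "assigned (2 * k) (k + 1) = None"
  proof (cases rule: Prc_cases)
    \<comment> \<open>Equal values give \<open>p = k\<close>, and then
      \<open>3 * k + 1 = k + 1\<close> contradicts \<open>k \<ge> 1\<close>.\<close>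
    case (second p)
    with v assms have False by simp
    then show ?thesis ..
  qed (use assms v in simp_all)
next
  assume "assigned (2 * k) (k + 1) = None"
  then have "assigned (2 * k + 1) (k + 1) = Some (2 * k + 1)"
    unfolding assigned_odd[OF assms] by simp
  with assigned_Prc[of "k + 1"] show "Prc (k + 1) = 2 * k + 1" by simp
qed

text \<open>An even value \<open>2 * p\<close> always sits at position \<open>3 * p\<close>, hence
  below its position.\<close>

lemma not_type_II:
  assumes "n \<ge> 1"
  shows "\<not> type_II n"
proof
  assume "type_II n"
  then have "Prc n = 2 * n"
    unfolding type_II_def by linarith
  with assms show False
    by (cases rule: Prc_cases) simp_all
qed

theorem theorem1:
  fixes n k :: nat
  assumes "n \<ge> 1" and "k \<ge> 1"
  shows "\<not> type_II n
    \<and> (n = 3 * k \<longrightarrow> type_IV n)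
    \<and> (n = 3 * k + 2 \<longrightarrow> type_I n)
    \<and> (n = 3 * k + 1 \<longrightarrow>
        (type_I (k + 1) \<longrightarrow> type_I n) \<and>
        (type_III (k + 1) \<or> type_IV (k + 1) \<longrightarrow> type_III n))"
proof (intro conjI impI)
  show "\<not> type_II n"
    using assms(1) by (rule not_type_II)
next
  assume "n = 3 * k"
  then show "type_IV n"
    using Prc_mod3_0[OF assms(2)] assms(2) by (simp add: type_IV_def)
next
  assume "n = 3 * k + 2"
  then show "type_I n"
    using Prc_mod3_2[of k] by (simp add: type_I_def)
next
  assume n: "n = 3 * k + 1" and "type_I (k + 1)"
  then have "real (Prc (k + 1)) = real (2 * k + 1)"
    by (simp add: type_I_def)
  then have "Prc (k + 1) = 2 * k + 1"
    by (simp only: of_nat_eq_iff)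
  then have "Prc n = 6 * k + 1"
    using Prc_mod3_1[OF assms(2)] Prc_eq_iff_unassigned[OF assms(2)] n by simp
  then show "type_I n"
    using n assms(2) by (simp add: type_I_def)
next
  assume n: "n = 3 * k + 1" and "type_III (k + 1) \<or> type_IV (k + 1)"
  \<comment> \<open>Of types (III) and (IV) only this inequality matters: it rules out the value
    \<open>2 * k + 1\<close>.\<close>
  then have "Prc (k + 1) < k + 1"
    by (auto simp: type_III_def type_IV_def)
  then have "Prc (k + 1) \<noteq> 2 * k + 1"
    by simp
  then have "Prc n = 2 * k + 1"
    using Prc_mod3_1[OF assms(2)] Prc_eq_iff_unassigned[OF assms(2)] n by auto
  then show "type_III n"
    using n assms(2) by (simp add: type_III_def)
qed

end
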